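(* For $n\ge0$ let $\mathcal S_n$ be the set of zigzag knight's paths (ending on the $x$-axis) of length $2n$, $\mathcal S=\bigcup_n\mathcal S_n$, and let $\mathcal D_n$ be the set of Dyck paths of length $2n$, $\mathcal D=\bigcup_n\mathcal D_n$. Define $\phi:\mathcal S\to\mathcal D$ recursively (writing paths as words): $\phi(\epsilon)=UD$; $\phi(E\bar E\beta)=U\phi(\beta)D$; $\phi(N\bar N\beta)=UD\phi(\beta)$; $\phi(N\bar E\beta E\bar N\gamma)=U\phi(\beta)D\phi(\gamma)$, for $\beta,\gamma\in\mathcal S$. Then for every $n\ge0$, $\phi$ induces a bijection between $\mathcal S_n$ and $\mathcal D_{n+1}$.
   Context: Let $N=(1,2)$, $\bar N=(1,-2)$, $E=(2,1)$, $\bar E=(2,-1)$; $N,E$ are up-steps and $\bar N,\bar E$ are down-steps. A knight's path is a lattice path in $\mathbb N^2$ starting at $(0,0)$, ending on the $x$-axis, with steps in $\{N,\bar N,E,\bar E\}$. A zigzag knight's path is a knight's path in which consecutive steps alternate between up-steps and down-steps; $\epsilon$ is the empty path; the length of a path is its number of steps. Every nonempty zigzag knight's path can be written uniquely in one of the forms $N\bar N\beta$, $E\bar E\beta$, $N\bar E\beta E\bar N\gamma$ with $\beta,\gamma$ (possibly empty) zigzag knight's paths. A Dyck path of length $2n$ is a lattice path in $\mathbb N^2$ from $(0,0)$ to $(2n,0)$ with steps $U=(1,1)$ and $D=(1,-1)$. *)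

theory Defs
  imports Main "HOL-Library.Product_Plus"
begin

text \<open>A path from the origin is a word of steps; \<open>vec\<close> gives the displacement vector of a step.
  All points visited, i.e. the end points of all prefixes, must lie in the quadrant of
  points with nonnegative integer coordinates.\<close>

definition endpoint :: "('s \<Rightarrow> int \<times> int) \<Rightarrow> 's list \<Rightarrow> int \<times> int" where
  "endpoint vec w = sum_list (map vec w)"

definition lattice_path :: "('s \<Rightarrow> int \<times> int) \<Rightarrow> 's list \<Rightarrow> bool" where
  "lattice_path vec w \<longleftrightarrow>
     (\<forall>k\<le>length w. 0 \<le> fst (endpoint vec (take k w)) \<and> 0 \<le> snd (endpoint vec (take k w)))"

datatype dyck_step = U | D

fun dyck_vec :: "dyck_step \<Rightarrow> int \<times> int" where
  "dyck_vec U = (1, 1)"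
| "dyck_vec D = (1, -1)"

text \<open>Each step advances the first coordinate by 1, so the end point forces length \<open>2 * n\<close>.\<close>

definition dyck_paths :: "nat \<Rightarrow> dyck_step list set" where
  "dyck_paths n = {w. lattice_path dyck_vec w \<and> endpoint dyck_vec w = (2 * int n, 0)}"

datatype knight_step = N | Nbar | E | Ebar

fun knight_vec :: "knight_step \<Rightarrow> int \<times> int" where
  "knight_vec N = (1, 2)"
| "knight_vec Nbar = (1, -2)"
| "knight_vec E = (2, 1)"
| "knight_vec Ebar = (2, -1)"

definition up_step :: "knight_step \<Rightarrow> bool" where
  "up_step s \<longleftrightarrow> s \<in> {N, E}"

definition knights_path :: "knight_step list \<Rightarrow> bool" where
  "knights_path w \<longleftrightarrow> lattice_path knight_vec w \<and> snd (endpoint knight_vec w) = 0"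

definition zigzag_knights_path :: "knight_step list \<Rightarrow> bool" where
  "zigzag_knights_path w \<longleftrightarrow> knights_path w \<and> successively (\<lambda>s t. up_step s \<noteq> up_step t) w"

definition zigzag_paths :: "nat \<Rightarrow> knight_step list set" where
  "zigzag_paths n = {w. zigzag_knights_path w \<and> length w = 2 * n}"

definition all_zigzag_paths :: "knight_step list set" where
  "all_zigzag_paths = (\<Union>n. zigzag_paths n)"

definition height :: "knight_step list \<Rightarrow> int" where
  "height w = snd (endpoint knight_vec w)"

lemma height_simps [simp]:
  "height [] = 0"
  "height (s # w) = snd (knight_vec s) + height w"
  "height (u @ v) = height u + height v"
  by (simp_all add: height_def endpoint_def)

lemma fst_endpoint_knight_nonneg: "0 \<le> fst (endpoint knight_vec w)"
proof (induction w)
  case (Cons s w)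
  then show ?case by (cases s) (simp_all add: endpoint_def)
qed (simp add: endpoint_def)

lemma lattice_path_knight_iff:
  "lattice_path knight_vec w \<longleftrightarrow> (\<forall>u v. w = u @ v \<longrightarrow> 0 \<le> height u)"
proof
  assume L: "lattice_path knight_vec w"
  show "\<forall>u v. w = u @ v \<longrightarrow> 0 \<le> height u"
  proof (intro allI impI)
    fix u v assume "w = u @ v"
    then have "take (length u) w = u" "length u \<le> length w" by auto
    then show "0 \<le> height u"
      using L unfolding lattice_path_def height_def by metis
  qed
next
  assume "\<forall>u v. w = u @ v \<longrightarrow> 0 \<le> height u"
  then have "0 \<le> height (take k w)" for k
    by (metis append_take_drop_id)
  then show "lattice_path knight_vec w"
    unfolding lattice_path_def by (simp add: fst_endpoint_knight_nonneg height_def)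
qed

lemma zigzag_knights_path_iff:
  "zigzag_knights_path w \<longleftrightarrow> successively (\<lambda>s t. up_step s \<noteq> up_step t) w \<and> height w = 0 \<and>
     (\<forall>u v. w = u @ v \<longrightarrow> 0 \<le> height u)"
  unfolding zigzag_knights_path_def knights_path_def lattice_path_knight_iff
  by (auto simp: height_def)

lemma zigzag_prefix: "zigzag_knights_path w \<Longrightarrow> w = u @ v \<Longrightarrow> 0 \<le> height u"
  by (simp add: zigzag_knights_path_iff)

lemma zigzag_suffixI:
  assumes "zigzag_knights_path (u @ v)" "height u = 0"
  shows "zigzag_knights_path v"
proof -
  have "0 \<le> height v1" if "v = v1 @ v2" for v1 v2
    using zigzag_prefix[OF assms(1), of "u @ v1" v2] that assms(2) by simp
  then show ?thesis
    using assms by (simp add: zigzag_knights_path_iff successively_append_iff)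
qed

lemma zigzag_first_return:
  assumes zz: "zigzag_knights_path (N # Ebar # v)"
  obtains \<beta> \<gamma> where "v = \<beta> @ E # Nbar # \<gamma>" "zigzag_knights_path \<beta>" "zigzag_knights_path \<gamma>"
proof -
  let ?alt = "\<lambda>s t. up_step s \<noteq> up_step t"
  have alt: "successively ?alt (N # Ebar # v)" and hv: "height v = -1"
    using zz by (auto simp: zigzag_knights_path_iff)
  have low: "-1 \<le> height u" if "v = u @ u'" for u u'
    using zigzag_prefix[OF zz, of "N # Ebar # u" u'] that by simp
  define k where "k = (LEAST k. height (take k v) < 0)"
  have ex: "height (take (length v) v) < 0" using hv by simp
  have k1: "height (take k v) < 0"
    unfolding k_def by (rule LeastI) (rule ex)
  have k2: "0 \<le> height (take j v)" if "j < k" for j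
    using not_less_Least[of j "\<lambda>k. height (take k v) < 0"] that unfolding k_def by fastforce
  have k3: "k \<le> length v" unfolding k_def by (rule Least_le) (rule ex)
  have k0: "k \<noteq> 0" using k1 by (intro notI) simp
  define p where "p = take (k - 1) v"
  define s where "s = v ! (k - 1)"
  define \<gamma> where "\<gamma> = drop k v"
  have v: "v = p @ s # \<gamma>"
    using k0 k3 id_take_nth_drop[of "k - 1" v] by (simp add: p_def s_def \<gamma>_def)
  have len_p: "length p = k - 1" using k3 by (simp add: p_def)
  have pos_p: "0 \<le> height u" if "p = u @ u'" for u u'
  proof -
    have "length u < k" using that len_p k0 by auto
    moreover have "take (length u) v = u" using that v by simp
    ultimately show ?thesis using k2[of "length u"] by simp
  qed
  have "take k v = p @ [s]" using v len_p k0 by (cases k) auto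
  then have hs: "height p + snd (knight_vec s) = -1"
    using k1 low[of "p @ [s]" \<gamma>] v by simp
  have s: "s = Nbar \<or> s = Ebar"
    using hs pos_p[of p "[]"] by (cases s) auto
  have "p \<noteq> []"
    using alt s v by (auto simp: up_step_def)
  then obtain \<beta> t where p: "p = \<beta> @ [t]" by (metis rev_exhaust)
  have t: "t = N \<or> t = E"
    using alt s unfolding v p
    by (cases t) (auto simp: up_step_def successively_append_iff successively_Cons)
  have "0 \<le> height \<beta>" using pos_p[of \<beta> "[t]"] p by simp
  then have ts: "t = E" "s = Nbar" "height \<beta> = 0"
    using hs t s unfolding p by auto
  have v': "v = \<beta> @ E # Nbar # \<gamma>" using v p ts by simp
  have "successively ?alt \<beta>" "successively ?alt \<gamma>"
    using alt unfolding v' by (auto simp: successively_append_iff successively_Cons)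
  moreover have "0 \<le> height u" if "\<beta> = u @ u'" for u u'
    using pos_p[of u "u' @ [t]"] p that by simp
  ultimately have "zigzag_knights_path \<beta>"
    using ts(3) by (simp add: zigzag_knights_path_iff)
  moreover have "zigzag_knights_path \<gamma>"
    by (rule zigzag_suffixI[of "N # Ebar # \<beta> @ [E, Nbar]"]) (use zz v' ts(3) in simp_all)
  ultimately show thesis using that v' by blast
qed

lemma zigzag_knights_path_cases:
  assumes zz: "zigzag_knights_path w"
  obtains "w = []"
  | \<beta> where "w = E # Ebar # \<beta>" "zigzag_knights_path \<beta>"
  | \<beta> where "w = N # Nbar # \<beta>" "zigzag_knights_path \<beta>"
  | \<beta> \<gamma> where "w = N # Ebar # \<beta> @ E # Nbar # \<gamma>" "zigzag_knights_path \<beta>" "zigzag_knights_path \<gamma>"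
proof (cases w)
  case (Cons s w')
  have s: "s = N \<or> s = E"
    using zigzag_prefix[OF zz, of "[s]" w'] Cons by (cases s) auto
  have "w' \<noteq> []"
    using zz Cons s by (auto simp: zigzag_knights_path_iff)
  then obtain t v where w: "w = s # t # v" using Cons by (cases w') auto
  have t: "t = Nbar \<or> t = Ebar"
    using zz s unfolding w by (cases t) (auto simp: zigzag_knights_path_iff up_step_def)
  have "0 \<le> height [s, t]"
    using zigzag_prefix[OF zz, of "[s, t]" v] w by simp
  then have "(s = E \<and> t = Ebar) \<or> (s = N \<and> t = Nbar) \<or> (s = N \<and> t = Ebar)"
    using s t by auto
  then show thesis
  proof (elim disjE conjE)
    assume "s = E" "t = Ebar"
    then show thesis using that(2)[of v] zigzag_suffixI[of "[E, Ebar]" v] zz w by simp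
  next
    assume "s = N" "t = Nbar"
    then show thesis using that(3)[of v] zigzag_suffixI[of "[N, Nbar]" v] zz w by simp
  next
    assume st: "s = N" "t = Ebar"
    then have "zigzag_knights_path (N # Ebar # v)" using zz w by simp
    then show thesis using zigzag_first_return that(4) w st by metis
  qed
qed (rule that(1))

lemma zigzag_even_length: "zigzag_knights_path w \<Longrightarrow> even (length w)"
proof (induction w rule: length_induct)
  case (1 w)
  from 1(2) show ?case
    by (cases rule: zigzag_knights_path_cases) (use 1(1) in auto)
qed

lemma all_zigzag_paths_iff: "w \<in> all_zigzag_paths \<longleftrightarrow> zigzag_knights_path w"
  using zigzag_even_length by (auto simp: all_zigzag_paths_def zigzag_paths_def elim: evenE)

lemma zigzag_split_aux:
  assumes "zigzag_knights_path \<beta>" "zigzag_knights_path \<beta>'"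
    and eq: "\<beta> @ E # Nbar # \<gamma> = \<beta>' @ E # Nbar # \<gamma>'"
    and le: "length \<beta> \<le> length \<beta>'"
  shows "\<beta> = \<beta>' \<and> \<gamma> = \<gamma>'"
proof -
  from eq le obtain d where d: "\<beta>' = \<beta> @ d"
    by (auto simp: append_eq_append_conv2)
  with eq have eq': "E # Nbar # \<gamma> = d @ E # Nbar # \<gamma>'" by simp
  have h: "height \<beta> = 0" "height \<beta>' = 0"
    using assms by (auto simp: zigzag_knights_path_iff)
  have "d = []"
  proof (rule ccontr)
    assume "d \<noteq> []"
    then obtain e where e: "d = E # e" using eq' by (cases d) auto
    show False
    proof (cases e)
      case Nil
      then show False using h d e by simp
    next
      case (Cons x f)
      then have "d = [E, Nbar] @ f" using e eq' by simp
      then show False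
        using zigzag_prefix[OF assms(2), of "\<beta> @ [E, Nbar]" f] d h by simp
    qed
  qed
  then show ?thesis using d eq by simp
qed

lemma zigzag_split_unique:
  assumes "\<beta> @ E # Nbar # \<gamma> = \<beta>' @ E # Nbar # \<gamma>'"
    and "\<beta> \<in> all_zigzag_paths" "\<beta>' \<in> all_zigzag_paths"
  shows "\<beta> = \<beta>' \<and> \<gamma> = \<gamma>'"
  using assms zigzag_split_aux unfolding all_zigzag_paths_iff by (metis nat_le_linear)

lemma all_zigzag_paths_intros:
  "[] \<in> all_zigzag_paths"
  "\<beta> \<in> all_zigzag_paths \<Longrightarrow> E # Ebar # \<beta> \<in> all_zigzag_paths"
  "\<beta> \<in> all_zigzag_paths \<Longrightarrow> N # Nbar # \<beta> \<in> all_zigzag_paths"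
  "\<beta> \<in> all_zigzag_paths \<Longrightarrow> \<gamma> \<in> all_zigzag_paths \<Longrightarrow>
     N # Ebar # \<beta> @ E # Nbar # \<gamma> \<in> all_zigzag_paths"
proof -
  have up: "successively (\<lambda>s t. up_step s \<noteq> up_step t) (s # w)"
    if "zigzag_knights_path w" "\<not> up_step s" for s w
    using that(1)
    by (cases rule: zigzag_knights_path_cases)
      (use that in \<open>auto simp: zigzag_knights_path_iff up_step_def\<close>)
  have down: "\<not> up_step (last w)" if zz: "zigzag_knights_path w" and ne: "w \<noteq> []" for w
  proof -
    have w: "w = butlast w @ [last w]" using ne by simp
    have "height w = 0" using zz by (simp add: zigzag_knights_path_iff)
    then have "height (butlast w) + snd (knight_vec (last w)) = 0"
      by (subst (asm) w, simp)
    then show ?thesis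
      using zigzag_prefix[OF zz w] by (cases "last w") (auto simp: up_step_def)
  qed
  have cons: "(\<forall>u v. s # w = u @ v \<longrightarrow> 0 \<le> h + height u) \<longleftrightarrow>
      0 \<le> h \<and> (\<forall>u v. w = u @ v \<longrightarrow> 0 \<le> (h + snd (knight_vec s)) + height u)" for s w and h :: int
  proof
    assume L: "\<forall>u v. s # w = u @ v \<longrightarrow> 0 \<le> h + height u"
    have "0 \<le> h" using L[rule_format, of "[]" "s # w"] by simp
    moreover have "0 \<le> (h + snd (knight_vec s)) + height u" if "w = u @ v" for u v
      using L[rule_format, of "s # u" v] that by simp
    ultimately show "0 \<le> h \<and> (\<forall>u v. w = u @ v \<longrightarrow> 0 \<le> (h + snd (knight_vec s)) + height u)"
      by blast
  next
    assume R: "0 \<le> h \<and> (\<forall>u v. w = u @ v \<longrightarrow> 0 \<le> (h + snd (knight_vec s)) + height u)"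
    show "\<forall>u v. s # w = u @ v \<longrightarrow> 0 \<le> h + height u"
    proof (intro allI impI)
      fix u v assume "s # w = u @ v"
      then show "0 \<le> h + height u" using R by (cases u) (auto simp: add.assoc)
    qed
  qed
  have app: "0 \<le> h + height u"
    if "\<forall>u v. x = u @ v \<longrightarrow> 0 \<le> h + height u" "\<forall>u v. y = u @ v \<longrightarrow> 0 \<le> (h + height x) + height u"
      "x @ y = u @ v" for x y u v and h :: int
    using that by (fastforce simp: append_eq_append_conv2 add.assoc)
  show "[] \<in> all_zigzag_paths"
    by (simp add: all_zigzag_paths_iff zigzag_knights_path_iff)
  show "E # Ebar # \<beta> \<in> all_zigzag_paths" if "\<beta> \<in> all_zigzag_paths"
  proof -
    have zz: "zigzag_knights_path \<beta>" using that by (simp add: all_zigzag_paths_iff)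
    then show ?thesis
      using up[OF zz, of Ebar] cons[of E "Ebar # \<beta>" 0] cons[of Ebar \<beta> 1]
      by (simp add: all_zigzag_paths_iff zigzag_knights_path_iff up_step_def)
  qed
  show "N # Nbar # \<beta> \<in> all_zigzag_paths" if "\<beta> \<in> all_zigzag_paths"
  proof -
    have zz: "zigzag_knights_path \<beta>" using that by (simp add: all_zigzag_paths_iff)
    then show ?thesis
      using up[OF zz, of Nbar] cons[of N "Nbar # \<beta>" 0] cons[of Nbar \<beta> 2]
      by (simp add: all_zigzag_paths_iff zigzag_knights_path_iff up_step_def)
  qed
  show "N # Ebar # \<beta> @ E # Nbar # \<gamma> \<in> all_zigzag_paths"
    if "\<beta> \<in> all_zigzag_paths" "\<gamma> \<in> all_zigzag_paths"
  proof -
    have zb: "zigzag_knights_path \<beta>" and zc: "zigzag_knights_path \<gamma>"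
      using that by (simp_all add: all_zigzag_paths_iff)
    have c: "\<forall>u v. E # Nbar # \<gamma> = u @ v \<longrightarrow> 0 \<le> 1 + height u"
      using zc cons[of E "Nbar # \<gamma>" 1] cons[of Nbar \<gamma> 2] by (simp add: zigzag_knights_path_iff)
    have b: "\<forall>u v. \<beta> = u @ v \<longrightarrow> 0 \<le> 1 + height u" and hb: "height \<beta> = 0"
      using zb by (auto simp: zigzag_knights_path_iff)
    have "\<forall>u v. \<beta> @ E # Nbar # \<gamma> = u @ v \<longrightarrow> 0 \<le> 1 + height u"
      using app[of \<beta> 1 "E # Nbar # \<gamma>"] b c hb by simp
    then have "\<forall>u v. N # Ebar # \<beta> @ E # Nbar # \<gamma> = u @ v \<longrightarrow> 0 \<le> height u"
      using cons[of N "Ebar # \<beta> @ E # Nbar # \<gamma>" 0] cons[of Ebar "\<beta> @ E # Nbar # \<gamma>" 2]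
      by simp
    moreover have "successively (\<lambda>s t. up_step s \<noteq> up_step t) (N # Ebar # \<beta> @ E # Nbar # \<gamma>)"
      using up[OF zb, of Ebar] up[OF zc, of Nbar] down[OF zb]
      by (cases "\<beta> = []") (auto simp: up_step_def successively_append_iff successively_Cons)
    ultimately show ?thesis
      using zb zc by (simp add: all_zigzag_paths_iff zigzag_knights_path_iff)
  qed
qed

function phi :: "knight_step list \<Rightarrow> dyck_step list" where
  "phi [] = [U, D]"
| "\<beta> \<in> all_zigzag_paths \<Longrightarrow> phi (E # Ebar # \<beta>) = U # phi \<beta> @ [D]"
| "\<beta> \<in> all_zigzag_paths \<Longrightarrow> phi (N # Nbar # \<beta>) = U # D # phi \<beta>"
| "\<beta> \<in> all_zigzag_paths \<Longrightarrow> \<gamma> \<in> all_zigzag_paths \<Longrightarrow>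
     phi (N # Ebar # \<beta> @ E # Nbar # \<gamma>) = U # phi \<beta> @ D # phi \<gamma>"
| "w \<notin> all_zigzag_paths \<Longrightarrow> phi w = undefined"
proof goal_cases
  case (1 P w)
  show P
  proof (cases "w \<in> all_zigzag_paths")
    case True
    then have "zigzag_knights_path w" by (simp add: all_zigzag_paths_iff)
    then show P
      by (cases rule: zigzag_knights_path_cases) (use 1 in \<open>auto simp: all_zigzag_paths_iff\<close>)
  qed (use 1 in blast)
qed (auto simp: all_zigzag_paths_intros dest: zigzag_split_unique)
termination by (relation "measure length") auto

end

theory Submission
  imports Defs
begin

text \<open>A nonempty Dyck path is uniquely \<open>U a D b\<close> with Dyck paths \<open>a\<close>, \<open>b\<close>. The four clauses of
  \<open>phi\<close> correspond to the four possibilities for which of \<open>a\<close>, \<open>b\<close> are empty, so unique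
  decomposition on both sides gives a bijection between zigzag paths and nonempty Dyck paths, and
  by induction \<open>phi w\<close> is longer than \<open>w\<close> by exactly 2.\<close>

text \<open>Carrying the current height as an argument also covers suffixes of Dyck paths, so that
  inductions can proceed one step at a time.\<close>

fun dyck_from :: "nat \<Rightarrow> dyck_step list \<Rightarrow> bool" where
  "dyck_from h [] \<longleftrightarrow> h = 0"
| "dyck_from h (U # w) \<longleftrightarrow> dyck_from (Suc h) w"
| "dyck_from 0 (D # w) \<longleftrightarrow> False"
| "dyck_from (Suc h) (D # w) \<longleftrightarrow> dyck_from h w"

lemma endpoint_simps [simp]:
  "endpoint vec [] = 0"
  "endpoint vec (s # w) = vec s + endpoint vec w"
  by (simp_all add: endpoint_def)

lemma fst_endpoint_dyck: "fst (endpoint dyck_vec w) = int (length w)"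
proof (induction w)
  case (Cons s w)
  then show ?case by (cases s) simp_all
qed simp

lemma all_le_Suc_iff: "(\<forall>k\<le>Suc n. P k) \<longleftrightarrow> P 0 \<and> (\<forall>k\<le>n. P (Suc k))"
  using less_Suc_eq_0_disj less_Suc_eq_le by auto

lemma dyck_from_iff:
  "dyck_from h w \<longleftrightarrow> (\<forall>k\<le>length w. 0 \<le> int h + snd (endpoint dyck_vec (take k w))) \<and>
     int h + snd (endpoint dyck_vec w) = 0"
proof (induction h w rule: dyck_from.induct)
  case (3 w)
  \<comment> \<open>Already the prefix of length 1 ends at height -1, so both sides are
    false.\<close>
  have "\<exists>k\<le>Suc (length w). snd (endpoint dyck_vec (take k (D # w))) < 0"
    by (rule exI[of _ 1]) simp
  then show ?case by (auto simp: not_le)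
qed (simp_all add: all_le_Suc_iff algebra_simps)

lemma dyck_paths_iff: "w \<in> dyck_paths n \<longleftrightarrow> dyck_from 0 w \<and> length w = 2 * n"
  by (auto simp: dyck_paths_def lattice_path_def dyck_from_iff fst_endpoint_dyck prod_eq_iff)

text \<open>Lifted by \<open>k\<close>, the path \<open>a\<close> never drops below \<open>k\<close>
  and ends there, which is where \<open>b\<close> starts.\<close>

lemma dyck_from_append: "dyck_from h a \<Longrightarrow> dyck_from (h + k) (a @ b) \<longleftrightarrow> dyck_from k b"
  by (induction h a rule: dyck_from.induct) simp_all

definition node :: "dyck_step list \<Rightarrow> dyck_step list \<Rightarrow> dyck_step list" where
  "node a b = U # a @ D # b"

lemma dyck_from_node: "dyck_from 0 a \<Longrightarrow> dyck_from 0 (node a b) \<longleftrightarrow> dyck_from 0 b"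
  using dyck_from_append[of 0 a 1 "D # b"] by (simp add: node_def)

text \<open>The separating \<open>D\<close> is the first step that goes below the starting
  height.\<close>

lemma dyck_from_split:
  assumes "dyck_from (Suc h) w"
  obtains a b where "w = a @ D # b" "dyck_from 0 a" "dyck_from h b"
proof -
  have "\<exists>a b. w = a @ D # b \<and> dyck_from 0 a \<and> dyck_from h b" using assms
  proof (induction w arbitrary: h rule: length_induct)
    case (1 w)
    show ?case
    proof (cases w)
      case Nil
      then show ?thesis using 1(2) by simp
    next
      case (Cons s v)
      show ?thesis
      proof (cases s)
        case U
        \<comment> \<open>After an initial \<open>U\<close> the rest must be split twice: the first
          \<open>D\<close> found only returns to the starting height, the second one goes below
          it.\<close>
        then have v: "dyck_from (Suc (Suc h)) v" using 1(2) Cons by simp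
        then obtain a b where ab: "v = a @ D # b" "dyck_from 0 a" "dyck_from (Suc h) b"
          using 1(1) Cons by fastforce
        moreover have "length b < length w" using Cons ab(1) by simp
        ultimately obtain c d where cd: "b = c @ D # d" "dyck_from 0 c" "dyck_from h d"
          using 1(1) by blast
        have "w = node a c @ D # d" using Cons U ab(1) cd(1) by (simp add: node_def)
        then show ?thesis using dyck_from_node ab(2) cd(2,3) by blast
      next
        case D
        then have "w = [] @ D # v" "dyck_from 0 []" "dyck_from h v" using 1(2) Cons by simp_all
        then show ?thesis by blast
      qed
    qed
  qed
  then show thesis using that by blast
qed

lemma dyck_cases:
  assumes "dyck_from 0 w"
  obtains "w = []"
  | a b where "w = node a b" "dyck_from 0 a" "dyck_from 0 b"
proof (cases w)
  case (Cons s v)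
  with assms have "s = U" "dyck_from (Suc 0) v" by (cases s; simp)+
  then show thesis using dyck_from_split that(2) Cons node_def by metis
qed (rule that(1))

text \<open>Read from height \<open>h\<close>, the displayed \<open>D\<close> is the first step to
  level -1, which fixes its position. Arbitrary \<open>h\<close> is needed for the induction along
  \<open>a\<close>.\<close>

lemma dyck_from_split_unique:
  assumes "dyck_from h a" "dyck_from h a'" "a @ D # b = a' @ D # b'"
  shows "a = a' \<and> b = b'"
  using assms
proof (induction h a arbitrary: a' rule: dyck_from.induct)
  case (1 h)
  then show ?case by (cases a') auto
next
  case (2 h w)
  obtain v where "a' = U # v" using "2.prems" by (cases a') auto
  then show ?case using "2.IH"[of v] "2.prems" by simp
next
  case (4 h w)
  obtain v where "a' = D # v" using "4.prems" by (cases a') auto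
  then show ?case using "4.IH"[of v] "4.prems" by simp
qed simp

lemma node_inject:
  assumes "dyck_from 0 a" "dyck_from 0 a'"
  shows "node a b = node a' b' \<longleftrightarrow> a = a' \<and> b = b'"
  using dyck_from_split_unique[OF assms] by (auto simp: node_def)

lemma all_zigzag_paths_induct [consumes 1, case_names empty EE NN NE]:
  assumes "w \<in> all_zigzag_paths"
    and "P []"
    and "\<And>\<beta>. \<beta> \<in> all_zigzag_paths \<Longrightarrow> P \<beta> \<Longrightarrow> P (E # Ebar # \<beta>)"
    and "\<And>\<beta>. \<beta> \<in> all_zigzag_paths \<Longrightarrow> P \<beta> \<Longrightarrow> P (N # Nbar # \<beta>)"
    and "\<And>\<beta> \<gamma>. \<beta> \<in> all_zigzag_paths \<Longrightarrow> P \<beta> \<Longrightarrow> \<gamma> \<in> all_zigzag_paths \<Longrightarrow> P \<gamma> \<Longrightarrow>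
           P (N # Ebar # \<beta> @ E # Nbar # \<gamma>)"
  shows "P w"
proof -
  \<comment> \<open>The recursion of \<open>phi\<close> supplies the induction; stating the goal as
    an implication makes its clause for other words vacuous.\<close>
  have "w \<in> all_zigzag_paths \<longrightarrow> P w"
    by (rule phi.induct) (use assms(2-) in auto)
  then show ?thesis using assms(1) by blast
qed

text \<open>This separates the clauses of \<open>phi\<close>: an empty factor of a
  \<open>node\<close> cannot be a value of \<open>phi\<close>.\<close>

lemma phi_not_Nil: "w \<in> all_zigzag_paths \<Longrightarrow> phi w \<noteq> []"
  by (induction rule: all_zigzag_paths_induct) simp_all

lemma length_phi: "w \<in> all_zigzag_paths \<Longrightarrow> length (phi w) = length w + 2"
  by (induction rule: all_zigzag_paths_induct) simp_all

lemma phi_node: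
  "phi [] = node [] []"
  "\<beta> \<in> all_zigzag_paths \<Longrightarrow> phi (E # Ebar # \<beta>) = node (phi \<beta>) []"
  "\<beta> \<in> all_zigzag_paths \<Longrightarrow> phi (N # Nbar # \<beta>) = node [] (phi \<beta>)"
  "\<beta> \<in> all_zigzag_paths \<Longrightarrow> \<gamma> \<in> all_zigzag_paths \<Longrightarrow>
     phi (N # Ebar # \<beta> @ E # Nbar # \<gamma>) = node (phi \<beta>) (phi \<gamma>)"
  by (simp_all add: node_def)

lemma dyck_from_phi: "w \<in> all_zigzag_paths \<Longrightarrow> dyck_from 0 (phi w)"
  by (induction rule: all_zigzag_paths_induct)
    (simp_all add: phi_node dyck_from_node del: phi.simps)

lemma inj_on_phi: "inj_on phi all_zigzag_paths"
proof (rule inj_onI)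
  fix w w' assume "w \<in> all_zigzag_paths" "w' \<in> all_zigzag_paths" "phi w = phi w'"
  then show "w = w'"
  proof (induction w arbitrary: w' rule: all_zigzag_paths_induct)
    case empty
    from empty.prems show ?case
      \<comment> \<open>If \<open>w'\<close> falls under another clause, \<open>node_inject\<close>
        equates \<open>[]\<close> with a value of \<open>phi\<close>. The three other cases argue
        alike, with the induction hypothesis applied to matching factors.\<close>
      by (cases w' rule: phi.cases)
        (auto simp: phi_node node_inject phi_not_Nil phi_not_Nil[symmetric] dyck_from_phi
          simp del: phi.simps)
  next
    case (EE \<beta>)
    from EE.prems EE.hyps show ?case
      by (cases w' rule: phi.cases)
        (auto simp: phi_node node_inject phi_not_Nil phi_not_Nil[symmetric] dyck_from_phi
          simp del: phi.simps dest: EE.IH)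
  next
    case (NN \<beta>)
    from NN.prems NN.hyps show ?case
      by (cases w' rule: phi.cases)
        (auto simp: phi_node node_inject phi_not_Nil phi_not_Nil[symmetric] dyck_from_phi
          simp del: phi.simps dest: NN.IH)
  next
    case (NE \<beta> \<gamma>)
    from NE.prems NE.hyps show ?case
      by (cases w' rule: phi.cases)
        (auto simp: phi_node node_inject phi_not_Nil phi_not_Nil[symmetric] dyck_from_phi
          simp del: phi.simps dest: NE.IH)
  qed
qed

lemma phi_surj:
  assumes "dyck_from 0 w" "w \<noteq> []"
  shows "w \<in> phi ` all_zigzag_paths"
  using assms
proof (induction w rule: length_induct)
  case (1 w)
  obtain a b where w: "w = node a b" and ab: "dyck_from 0 a" "dyck_from 0 b"
    using 1(2,3) by (cases rule: dyck_cases) auto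
  \<comment> \<open>Both factors are shorter than \<open>w\<close>, so each is empty or has a
    preimage by induction.\<close>
  have a: "a = [] \<or> (\<exists>\<beta>\<in>all_zigzag_paths. a = phi \<beta>)"
    using 1(1)[rule_format, of a] ab(1) by (auto simp: w node_def)
  have b: "b = [] \<or> (\<exists>\<gamma>\<in>all_zigzag_paths. b = phi \<gamma>)"
    using 1(1)[rule_format, of b] ab(2) by (auto simp: w node_def)
  show ?case
    \<comment> \<open>Each of the four combinations is the right-hand side of one equation in
      \<open>phi_node\<close>, which yields the preimage.\<close>
    using a b
    by (elim disjE bexE)
      (auto simp: w phi_node[symmetric] simp del: phi.simps
        intro!: imageI all_zigzag_paths_intros)
qed

theorem theorem5:
  fixes n :: nat
  shows "bij_betw phi (zigzag_paths n) (dyck_paths (n + 1))"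
proof -
  have Z: "w \<in> zigzag_paths n \<longleftrightarrow> w \<in> all_zigzag_paths \<and> length w = 2 * n" for w
    by (auto simp: zigzag_paths_def all_zigzag_paths_iff)
  have "inj_on phi (zigzag_paths n)"
    using inj_on_phi by (rule inj_on_subset) (auto simp: Z)
  moreover have "phi ` zigzag_paths n = dyck_paths (n + 1)"
  proof
    show "phi ` zigzag_paths n \<subseteq> dyck_paths (n + 1)"
      by (auto simp: Z dyck_paths_iff dyck_from_phi length_phi)
    show "dyck_paths (n + 1) \<subseteq> phi ` zigzag_paths n"
    proof
      fix w assume "w \<in> dyck_paths (n + 1)"
      then have w: "dyck_from 0 w" "length w = 2 * n + 2" by (simp_all add: dyck_paths_iff)
      \<comment> \<open>Since \<open>2 * n + 2\<close> is positive, \<open>w\<close> is nonempty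
        even for \<open>n = 0\<close>; \<open>length_phi\<close> then gives the length of
        \<open>z\<close>.\<close>
      then obtain z where "z \<in> all_zigzag_paths" "w = phi z"
        using phi_surj[of w] by fastforce
      then show "w \<in> phi ` zigzag_paths n" using w(2) by (auto simp: Z length_phi)
    qed
  qed
  ultimately show ?thesis by (simp add: bij_betw_def)
qed

end
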